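(* Let $m\ge 2$ and $\ell\ge 3$ be integers. The graph $W(m,\ell)$ is bipartite and not $3$-connected. Moreover, $W(m,\ell)$ is distance-balanced if and only if $\ell$ is odd.
   Context: For $0\le i\le 4\ell-1$ let $f(i)=1$ if $i\equiv 0$ or $3 \pmod 4$, and $f(i)=m$ otherwise. $W(m,\ell)$ is the graph with vertex set $\{(i,j): 0\le i\le 4\ell-1,\ 1\le j\le f(i)\}$ in which $(i_1,j_1)$ and $(i_2,j_2)$ are adjacent iff $i_2-i_1\equiv \pm1 \pmod{4\ell}$ (i.e. the cycle of length $4\ell$ with every second pair of consecutive vertices replaced by a complete bipartite graph $K_{m,m}$). For $u,v$ let $W_{uv}=\{z: d(u,z)<d(v,z)\}$; a connected graph is distance-balanced if $|W_{uv}|=|W_{vu}|$ for all adjacent $u,v$. A graph is $3$-connected if it has at least $4$ vertices and removing any at most $2$ vertices leaves it connected. *)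

theory Defs
  imports "Graph_Theory.Graph_Theory" "HOL-Number_Theory.Cong"
begin

text \<open>
  Undirected graphs are represented as symmetric digraphs, so each edge is a pair of opposite arcs.
\<close>

definition bipartite :: "('a, 'b) pre_digraph \<Rightarrow> bool" where
  "bipartite G \<longleftrightarrow> (\<exists>U V. verts G = U \<union> V \<and> U \<inter> V = {} \<and>
     arcs_ends G \<subseteq> U \<times> V \<union> V \<times> U)"

definition three_connected :: "('a, 'b) pre_digraph \<Rightarrow> bool" where
  "three_connected G \<longleftrightarrow> card (verts G) \<ge> 4 \<and>
     (\<forall>S \<subseteq> verts G. finite S \<and> card S \<le> 2 \<longrightarrow>
        Digraph_Component.connected (G \<restriction> (verts G - S)))"

text \<open>The infimum of the lengths of all walks, hence \<open>\<infinity>\<close> if there is none.\<close>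

definition graph_dist :: "('a, 'b) pre_digraph \<Rightarrow> 'a \<Rightarrow> 'a \<Rightarrow> ereal" where
  "graph_dist G u v = wf_digraph.\<mu> G (\<lambda>_. 1) u v"

definition closer_set :: "('a, 'b) pre_digraph \<Rightarrow> 'a \<Rightarrow> 'a \<Rightarrow> 'a set" where
  "closer_set G u v = {z \<in> verts G. graph_dist G u z < graph_dist G v z}"

definition distance_balanced :: "('a, 'b) pre_digraph \<Rightarrow> bool" where
  "distance_balanced G \<longleftrightarrow> Digraph_Component.connected G \<and>
     (\<forall>u v. u \<rightarrow>\<^bsub>G\<^esub> v \<longrightarrow> card (closer_set G u v) = card (closer_set G v u))"

definition layer_size :: "nat \<Rightarrow> nat \<Rightarrow> nat" where
  "layer_size m i = (if i mod 4 = 0 \<or> i mod 4 = 3 then 1 else m)"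

definition W_verts :: "nat \<Rightarrow> nat \<Rightarrow> (nat \<times> nat) set" where
  "W_verts m l = {(i, j). i < 4 * l \<and> 1 \<le> j \<and> j \<le> layer_size m i}"

definition W_graph :: "nat \<Rightarrow> nat \<Rightarrow> (nat \<times> nat) pair_pre_digraph" where
  "W_graph m l = \<lparr> pverts = W_verts m l,
     parcs = {((i1, j1), (i2, j2)). (i1, j1) \<in> W_verts m l \<and> (i2, j2) \<in> W_verts m l \<and>
       ([int i2 - int i1 = 1] (mod (4 * int l)) \<or> [int i2 - int i1 = -1] (mod (4 * int l)))} \<rparr>"

lemma finite_W_verts: "finite (W_verts m l)"
proof (rule finite_subset)
  show "W_verts m l \<subseteq> {..<4 * l} \<times> {..max 1 m}"
    by (auto simp: W_verts_def layer_size_def split: if_splits)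
qed simp

lemma pair_graph_W_graph: "pair_graph (W_graph m l)"
proof
  show "finite (pverts (W_graph m l))"
    by (simp add: W_graph_def finite_W_verts)
  show "finite (parcs (W_graph m l))"
    by (rule finite_subset[OF _ finite_cartesian_product[OF finite_W_verts finite_W_verts]])
       (auto simp: W_graph_def)
  show "symmetric (with_proj (W_graph m l))"
  proof -
    have "[b - a = 1] (mod n) \<longleftrightarrow> [a - b = -1] (mod n)" for a b n :: int
      using cong_minus_minus_iff[of "b - a" 1 n] by simp
    then show ?thesis
      by (auto simp: symmetric_def W_graph_def intro!: symI)
  qed
next
  fix e assume e: "e \<in> parcs (W_graph m l)"
  then show "fst e \<in> pverts (W_graph m l)" "snd e \<in> pverts (W_graph m l)"
    by (auto simp: W_graph_def)
  from e have l: "l > 0"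
    by (auto simp: W_graph_def W_verts_def intro: gr0I)
  show "fst e \<noteq> snd e"
  proof
    assume "fst e = snd e"
    with e have "4 * int l dvd 1"
      by (auto simp: W_graph_def cong_iff_dvd_diff)
    with l show False by (auto dest: zdvd_imp_le)
  qed
qed

end

theory Submission
  imports Defs
begin

text \<open>
  Replacing vertices of the cycle of length \<open>4l\<close> by independent layers changes distances only inside
  a layer, where they become 2. Hence, for an edge from \<open>u\<close> in layer \<open>i\<close> to \<open>v\<close> in layer \<open>i + 1\<close>, the
  vertices closer to \<open>u\<close> are \<open>u\<close> itself, layer \<open>i + 1\<close> without \<open>v\<close>, and the \<open>2l - 1\<close> layers preceding
  layer \<open>i\<close>; symmetrically for \<open>v\<close>. The layer sizes have period 4, and two layers whose indices
  differ by 2 have \<open>m + 1\<close> vertices together. So if \<open>l\<close> is odd, both counts equal \<open>l (m + 1)\<close>; if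
  \<open>l\<close> is even, the counts for the edge between layers 0 and 1 differ by \<open>2 (m - 1)\<close>.
  Bipartiteness is the parity of the layer index, and the layers 0 and 3 form a 2-cut.
\<close>

section \<open>Distances certified by a level function\<close>

context wf_digraph
begin

lemma awalk_level_le:
  fixes D :: "'a \<Rightarrow> nat"
  assumes "\<And>x y. x \<rightarrow>\<^bsub>G\<^esub> y \<Longrightarrow> D y \<le> D x + 1" and "awalk u p v"
  shows "D v \<le> D u + length p"
  using assms(2)
proof (induction p arbitrary: u)
  case Nil
  then show ?case by (simp add: awalk_Nil_iff)
next
  case (Cons e p)
  then have "D v \<le> D (head G e) + length p" and "tail G e = u" and "e \<in> arcs G"
    by (auto simp: awalk_Cons_iff)
  moreover have "D (head G e) \<le> D (tail G e) + 1"
    using \<open>e \<in> arcs G\<close> by (intro assms(1)) (rule in_arcs_imp_in_arcs_ends)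
  ultimately show ?case by simp
qed

lemma awalk_of_descent:
  fixes D :: "'a \<Rightarrow> nat"
  assumes "\<And>y. y \<in> verts G \<Longrightarrow> y \<noteq> u \<Longrightarrow> \<exists>x. x \<rightarrow>\<^bsub>G\<^esub> y \<and> D y = D x + 1"
    and "D u = 0" and "u \<in> verts G" and "v \<in> verts G"
  shows "\<exists>p. awalk u p v \<and> length p = D v"
  using assms(4)
proof (induction "D v" arbitrary: v)
  case 0
  \<comment> \<open>Every vertex other than \<open>u\<close> lies one level above some vertex, so
    only \<open>u\<close> can have level 0.\<close>
  then have "v = u" using assms(1)[of v] by auto
  then show ?case using assms by (auto simp: awalk_Nil_iff intro: exI[of _ "[]"])
next
  case (Suc n)
  then have "v \<noteq> u" using assms(2) by auto
  then obtain x where x: "x \<rightarrow>\<^bsub>G\<^esub> v" "D v = D x + 1" using assms(1) Suc.prems by blast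
  then obtain p where p: "awalk u p x" "length p = D x"
    using Suc.hyps adj_in_verts(1) by (metis Suc_eq_plus1 Suc_inject)
  obtain e where e: "e \<in> arcs G" "tail G e = x" "head G e = v"
    using x(1) by auto
  have "awalk x [e] v" using e by (auto simp: awalk_simps)
  then have "awalk u (p @ [e]) v" using p(1) by (rule awalk_appendI[rotated])
  then show ?case using p(2) x(2) by (intro exI[of _ "p @ [e]"]) simp
qed

text \<open>The two hypotheses give the two inequalities. Growth by at most 1 along an arc bounds
  every walk to \<open>v\<close> from below by \<open>D v\<close>; descending level by level gives a
  walk of exactly that length. A distance formula can thus be verified locally.\<close>

lemma graph_dist_eq_level:
  fixes D :: "'a \<Rightarrow> nat"
  assumes "\<And>x y. x \<rightarrow>\<^bsub>G\<^esub> y \<Longrightarrow> D y \<le> D x + 1"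
    and "\<And>y. y \<in> verts G \<Longrightarrow> y \<noteq> u \<Longrightarrow> \<exists>x. x \<rightarrow>\<^bsub>G\<^esub> y \<and> D y = D x + 1"
    and "D u = 0" and "u \<in> verts G" and "v \<in> verts G"
  shows "graph_dist G u v = ereal (real (D v))"
proof -
  have cost: "awalk_cost (\<lambda>_. 1) p = real (length p)" for p :: "'b list"
    by (induction p) auto
  obtain p where "awalk u p v" "length p = D v"
    using awalk_of_descent[of u D v] assms by blast
  then have "graph_dist G u v \<le> ereal (real (D v))"
    unfolding graph_dist_def using min_cost_le_walk_cost[of u p v "\<lambda>_. 1"] by (simp add: cost)
  moreover have "ereal (real (D v)) \<le> graph_dist G u v"
    unfolding graph_dist_def \<mu>_def
    using awalk_level_le[of D u _ v] assms by (auto intro!: INF_greatest simp: cost)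
  ultimately show ?thesis by simp
qed

end

section \<open>Adjacency and distance in \<open>W(m, l)\<close>\<close>

lemma int_diff_cong_one_iff:
  fixes a b n :: nat
  assumes "b < n"
  shows "[int b - int a = 1] (mod (int n)) \<longleftrightarrow> b = Suc a mod n"
proof -
  have "[int b - int a = 1] (mod (int n)) \<longleftrightarrow> [int b = int (Suc a)] (mod (int n))"
    by (simp add: cong_iff_dvd_diff algebra_simps)
  also have "\<dots> \<longleftrightarrow> [b = Suc a] (mod n)" by (simp only: cong_int_iff)
  finally show ?thesis using assms by (simp add: cong_def)
qed

lemma pverts_W_graph [simp]: "pverts (W_graph m l) = W_verts m l"
  by (simp add: W_graph_def)

lemma W_graph_adj_iff:
  "((a, j), (b, k)) \<in> parcs (W_graph m l) \<longleftrightarrow>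
    (a, j) \<in> W_verts m l \<and> (b, k) \<in> W_verts m l \<and>
    (b = Suc a mod (4 * l) \<or> a = Suc b mod (4 * l))"
proof (cases "a < 4 * l \<and> b < 4 * l")
  case True
  have "[int b - int a = - 1] (mod (4 * int l)) \<longleftrightarrow> [int a - int b = 1] (mod (4 * int l))"
    using cong_minus_minus_iff[of "int a - int b" 1 "4 * int l"] by simp
  then show ?thesis
    using True int_diff_cong_one_iff[of b "4 * l" a] int_diff_cong_one_iff[of a "4 * l" b]
    by (auto simp: W_graph_def)
qed (auto simp: W_graph_def W_verts_def)

definition cycle_dist :: "nat \<Rightarrow> nat \<Rightarrow> nat \<Rightarrow> nat" where
  "cycle_dist n a b = (if a \<le> b then min (b - a) (n - (b - a)) else min (a - b) (n - (a - b)))"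

text \<open>The value 2 arises because a layer is independent, while any two of its vertices share
  all their neighbours.\<close>

definition W_dist :: "nat \<Rightarrow> nat \<times> nat \<Rightarrow> nat \<times> nat \<Rightarrow> nat" where
  "W_dist l u v = (if fst u = fst v then (if snd u = snd v then 0 else 2)
     else cycle_dist (4 * l) (fst u) (fst v))"

lemma Suc_mod_eq: "a < n \<Longrightarrow> Suc a mod n = (if Suc a = n then 0 else Suc a)" for a n :: nat
  by auto

lemma one_in_W_verts: "m \<ge> 1 \<Longrightarrow> a < 4 * l \<Longrightarrow> (a, 1) \<in> W_verts m l"
  by (auto simp: W_verts_def layer_size_def)

lemma cycle_dist_commute: "cycle_dist n a b = cycle_dist n b a"
  by (auto simp: cycle_dist_def)

text \<open>On a cycle of even length no step keeps the distance to \<open>a\<close>: it grows while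
  \<open>b\<close> is among the \<open>h\<close> positions starting at \<open>a\<close>, and shrinks
  on the other half. The disjunct \<open>b + h < a\<close> is the part of the growing half that has
  wrapped past 0.\<close>

lemma cycle_dist_Suc_mod:
  assumes "a < 2 * h" and "b < 2 * h"
  shows "if a \<le> b \<and> b < a + h \<or> b + h < a
    then cycle_dist (2 * h) a (Suc b mod (2 * h)) = cycle_dist (2 * h) a b + 1
    else cycle_dist (2 * h) a b = cycle_dist (2 * h) a (Suc b mod (2 * h)) + 1"
proof -
  have mod: "cycle_dist (2 * h) a (Suc b mod (2 * h)) = cycle_dist (2 * h) a (Suc b)"
    using assms by (auto simp: Suc_mod_eq cycle_dist_def)
  show ?thesis
  proof (cases "a \<le> b")
    case True
    then obtain d where "b = a + d" using le_iff_add by blast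
    then show ?thesis using assms unfolding mod by (auto simp: cycle_dist_def min_def)
  next
    case False
    then obtain d where "a = Suc (b + d)" by (metis less_imp_Suc_add not_le)
    then show ?thesis using assms unfolding mod by (auto simp: cycle_dist_def min_def)
  qed
qed

lemma W_dist_Lipschitz:
  assumes "u \<in> W_verts m l" and "x \<rightarrow>\<^bsub>with_proj (W_graph m l)\<^esub> y"
  shows "W_dist l u y \<le> W_dist l u x + 1"
proof -
  obtain a j b k c i where [simp]: "x = (a, j)" "y = (b, k)" "u = (c, i)"
    by (metis surj_pair)
  have bounds: "a < 2 * (2 * l)" "b < 2 * (2 * l)" "c < 2 * (2 * l)"
    using assms by (auto simp: W_graph_adj_iff W_verts_def)
  have adj: "b = Suc a mod (4 * l) \<or> a = Suc b mod (4 * l)"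
    using assms(2) by (simp add: W_graph_adj_iff)
  have "cycle_dist (4 * l) c b \<le> cycle_dist (4 * l) c a + 1"
    \<comment> \<open>The exact change by 1 is needed when \<open>y\<close> lies in the layer of
      \<open>u\<close>: then \<open>x\<close> is at distance 1, and the value 2 is still allowed for
      \<open>y\<close>.\<close>
    and "cycle_dist (4 * l) c a = cycle_dist (4 * l) c b + 1 \<or>
      cycle_dist (4 * l) c b = cycle_dist (4 * l) c a + 1"
    using adj cycle_dist_Suc_mod[OF bounds(3,1)] cycle_dist_Suc_mod[OF bounds(3,2)]
    by (auto split: if_splits)
  moreover have "cycle_dist (4 * l) c c = 0" by (simp add: cycle_dist_def)
  ultimately show ?thesis by (auto simp: W_dist_def)
qed

lemma cycle_dist_descent:
  assumes "a < 2 * h" and "b < 2 * h" and "a \<noteq> b"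
  shows "\<exists>c<2 * h. (b = Suc c mod (2 * h) \<or> c = Suc b mod (2 * h)) \<and>
    cycle_dist (2 * h) a b = cycle_dist (2 * h) a c + 1"
proof (cases "a \<le> b \<and> b < a + h \<or> b + h < a")
  case True
  \<comment> \<open>\<open>p\<close> is the cyclic predecessor of \<open>b\<close>. Since
    \<open>b\<close> differs from \<open>a\<close>, it still lies in the growing half, so stepping
    back lowers the distance; in the other case stepping forward does.\<close>
  define p where "p = (if b = 0 then 2 * h - 1 else b - 1)"
  have p: "p < 2 * h" "b = Suc p mod (2 * h)"
    using assms by (auto simp: p_def Suc_mod_eq)
  have "a \<le> p \<and> p < a + h \<or> p + h < a"
    using True assms by (auto simp: p_def)
  then show ?thesis
    using cycle_dist_Suc_mod[OF assms(1) p(1)] p by (intro exI[of _ p]) simp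
next
  case False
  have "Suc b mod (2 * h) < 2 * h" using assms by simp
  then show ?thesis
    using cycle_dist_Suc_mod[OF assms(1,2)] False by (intro exI[of _ "Suc b mod (2 * h)"]) simp
qed

lemma W_dist_descent:
  assumes "l > 0" and "m \<ge> 1" and "u \<in> W_verts m l" and "y \<in> W_verts m l" and "y \<noteq> u"
  shows "\<exists>x. x \<rightarrow>\<^bsub>with_proj (W_graph m l)\<^esub> y \<and> W_dist l u y = W_dist l u x + 1"
proof -
  obtain b k c i where [simp]: "y = (b, k)" "u = (c, i)"
    by (metis surj_pair)
  have bounds: "b < 4 * l" "c < 4 * l" using assms by (auto simp: W_verts_def)
  show ?thesis
  proof (cases "b = c")
    case True
    let ?x = "(Suc b mod (4 * l), 1 :: nat)"
    have "?x \<rightarrow>\<^bsub>with_proj (W_graph m l)\<^esub> y"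
      using assms one_in_W_verts[of m "Suc b mod (4 * l)" l] by (simp add: W_graph_adj_iff)
    moreover have "W_dist l u y = W_dist l u ?x + 1"
      using True bounds assms(1,5) by (cases b) (auto simp: W_dist_def cycle_dist_def Suc_mod_eq)
    ultimately show ?thesis by blast
  next
    case False
    then obtain d where d: "d < 4 * l" "b = Suc d mod (4 * l) \<or> d = Suc b mod (4 * l)"
      "cycle_dist (4 * l) c b = cycle_dist (4 * l) c d + 1"
      using cycle_dist_descent[of c "2 * l" b] bounds by auto
    \<comment> \<open>Any vertex of layer \<open>d\<close> will do, except in the layer of
      \<open>u\<close>: there only \<open>u\<close> itself has level 0, the others have level
      2.\<close>
    define x where "x = (if d = c then u else (d, 1))"
    have "x \<rightarrow>\<^bsub>with_proj (W_graph m l)\<^esub> y"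
      using assms d one_in_W_verts[of m d l] by (auto simp: W_graph_adj_iff x_def)
    moreover have "W_dist l u y = W_dist l u x + 1"
      using False d(3) by (auto simp: W_dist_def x_def cycle_dist_def)
    ultimately show ?thesis by blast
  qed
qed

lemma wf_digraph_W_graph: "wf_digraph (with_proj (W_graph m l))"
proof -
  interpret pair_graph "W_graph m l" by (rule pair_graph_W_graph)
  show ?thesis by unfold_locales
qed

lemma W_dist_refl [simp]: "W_dist l u u = 0"
  by (simp add: W_dist_def)

lemma graph_dist_W_graph:
  assumes "l > 0" and "m \<ge> 1" and "u \<in> W_verts m l" and "v \<in> W_verts m l"
  shows "graph_dist (with_proj (W_graph m l)) u v = ereal (real (W_dist l u v))"
proof (rule wf_digraph.graph_dist_eq_level[OF wf_digraph_W_graph])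
  show "W_dist l u y \<le> W_dist l u x + 1" if "x \<rightarrow>\<^bsub>with_proj (W_graph m l)\<^esub> y" for x y
    using W_dist_Lipschitz[OF assms(3) that] .
  show "\<exists>x. x \<rightarrow>\<^bsub>with_proj (W_graph m l)\<^esub> y \<and> W_dist l u y = W_dist l u x + 1"
    if "y \<in> verts (with_proj (W_graph m l))" "y \<noteq> u" for y
    using W_dist_descent[OF assms(1-3)] that by simp
qed (use assms in simp_all)

lemma connected_W_graph:
  assumes "l > 0" and "m \<ge> 1"
  shows "Digraph_Component.connected (with_proj (W_graph m l))"
proof -
  interpret wf_digraph "with_proj (W_graph m l)" by (rule wf_digraph_W_graph)
  have "W_verts m l \<noteq> {}" using one_in_W_verts[of m 0 l] assms by auto
  moreover have "u \<rightarrow>\<^sup>*\<^bsub>with_proj (W_graph m l)\<^esub> v" if "u \<in> W_verts m l" "v \<in> W_verts m l" for u v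
    using awalk_of_descent[of u "W_dist l u" v] W_dist_descent[OF assms that(1)] that
    by (auto simp: reachable_awalk)
  ultimately show ?thesis
    unfolding connected_def strongly_connected_def
    using reachable_mk_symmetricI by auto
qed

section \<open>Counting the closer vertices\<close>

text \<open>Runs of consecutive layers are written as reduced intervals, so wrapping around needs no
  case split. At most \<open>4 * l\<close> consecutive indices meet each layer at most once, and
  reduction modulo \<open>4 * l\<close> keeps the residue modulo 4 that determines the layer
  size.\<close>

lemma card_W_verts_layers:
  assumes "l > 0" and "b \<le> a + 4 * l"
  shows "card {z \<in> W_verts m l. fst z \<in> (\<lambda>k. k mod (4 * l)) ` {a..<b}} =
    (\<Sum>k = a..<b. layer_size m k)"
proof -
  let ?M = "\<lambda>k. k mod (4 * l)"
  have inj: "inj_on ?M {a..<b}"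
  proof (rule linorder_inj_onI)
    fix x y assume xy: "x < y" "x \<in> {a..<b}" "y \<in> {a..<b}"
    show "?M x \<noteq> ?M y"
    proof
      assume "?M x = ?M y"
      then have "4 * l dvd y - x" using xy(1) by (metis mod_eq_dvd_iff_nat less_imp_le)
      then show False using xy assms(2) by (auto dest: dvd_imp_le)
    qed
  qed auto
  have "{z \<in> W_verts m l. fst z \<in> ?M ` {a..<b}} = Sigma (?M ` {a..<b}) (\<lambda>i. {1..layer_size m i})"
    using assms(1) by (auto simp: W_verts_def)
  then have "card {z \<in> W_verts m l. fst z \<in> ?M ` {a..<b}} = (\<Sum>i\<in>?M ` {a..<b}. layer_size m i)"
    by simp
  also have "\<dots> = (\<Sum>k = a..<b. layer_size m (k mod (4 * l)))"
    using inj by (simp add: sum.reindex)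
  also have "\<dots> = (\<Sum>k = a..<b. layer_size m k)"
    by (intro sum.cong) (auto simp: layer_size_def mod_mod_cancel)
  finally show ?thesis .
qed

text \<open>Below \<open>2 * n\<close>, the only numbers with residue \<open>k\<close> are
  \<open>k\<close> and \<open>k + n\<close>.\<close>

lemma mem_mod_image_iff:
  fixes a b k n :: nat
  assumes "k < n" and "b \<le> 2 * n"
  shows "k \<in> (\<lambda>x. x mod n) ` {a..<b} \<longleftrightarrow> a \<le> k \<and> k < b \<or> a \<le> k + n \<and> k + n < b"
proof
  assume "k \<in> (\<lambda>x. x mod n) ` {a..<b}"
  then obtain x where x: "a \<le> x" "x < b" "k = x mod n" by auto
  then show "a \<le> k \<and> k < b \<or> a \<le> k + n \<and> k + n < b"
    using assms by (cases "x < n") (auto simp: le_mod_geq)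
next
  assume "a \<le> k \<and> k < b \<or> a \<le> k + n \<and> k + n < b"
  then show "k \<in> (\<lambda>x. x mod n) ` {a..<b}"
    using assms(1) by (auto intro: image_eqI[of _ _ k] image_eqI[of _ _ "k + n"])
qed

text \<open>Seen from \<open>k\<close>, the step from \<open>i\<close> to \<open>i + 1\<close> moves
  away exactly if \<open>i\<close> is among the \<open>2 * l\<close> positions starting at
  \<open>k\<close>, that is, if \<open>k\<close> is among the \<open>2 * l\<close> positions ending
  at \<open>i\<close>. Leaving out the two end layers of the edge leaves \<open>2 * l - 1\<close>
  layers on each side.\<close>

lemma cycle_dist_less_iff:
  assumes "i < 4 * l" and "k < 4 * l" and "k \<noteq> i" and "k \<noteq> Suc i mod (4 * l)"
  shows "cycle_dist (4 * l) i k < cycle_dist (4 * l) (Suc i mod (4 * l)) k \<longleftrightarrow>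
      k \<in> (\<lambda>x. x mod (4 * l)) ` {i + 2 * l + 1..<i + 4 * l}" (is ?less)
    and "cycle_dist (4 * l) (Suc i mod (4 * l)) k < cycle_dist (4 * l) i k \<longleftrightarrow>
      k \<in> (\<lambda>x. x mod (4 * l)) ` {i + 2..<i + 2 * l + 1}" (is ?greater)
proof -
  have "i + 4 * l \<le> 2 * (4 * l)" "i + 2 * l + 1 \<le> 2 * (4 * l)" using assms by auto
  note mem = this[THEN mem_mod_image_iff[OF assms(2)]]
  have bounds: "k < 2 * (2 * l)" "i < 2 * (2 * l)" using assms by auto
  have "k < i \<or> Suc i < k" "Suc i < 4 * l \<or> 0 < k"
    using assms by (auto simp: Suc_mod_eq split: if_splits)
  then show ?less ?greater
    unfolding mem using cycle_dist_Suc_mod[OF bounds] assms(1,2)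
    by (auto simp: cycle_dist_commute[of _ _ k] split: if_splits)
qed

text \<open>The endpoint counted on its own side makes up for the endpoint missing from the opposite
  layer, so the full size of that layer appears.\<close>

lemma card_closer_sets:
  assumes "l > 0" and "m \<ge> 1" and "i < 4 * l"
    and u: "(i, j) \<in> W_verts m l" and v: "(Suc i mod (4 * l), k) \<in> W_verts m l"
  shows "card (closer_set (with_proj (W_graph m l)) (i, j) (Suc i mod (4 * l), k)) =
      layer_size m (Suc i) + (\<Sum>k = i + 2 * l + 1..<i + 4 * l. layer_size m k)" (is ?closer_u)
    and "card (closer_set (with_proj (W_graph m l)) (Suc i mod (4 * l), k) (i, j)) =
      layer_size m i + (\<Sum>k = i + 2..<i + 2 * l + 1. layer_size m k)" (is ?closer_v)
proof -
  let ?s = "Suc i mod (4 * l)" and ?M = "\<lambda>x. x mod (4 * l)"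
  let ?L = "\<lambda>a b. {z \<in> W_verts m l. fst z \<in> ?M ` {a..<b}}"
  let ?R = "\<lambda>i j. Pair i ` ({1..layer_size m i} - {j})"
  have s: "?s < 4 * l" "?s \<noteq> i" using assms(1,3) by (simp_all add: Suc_mod_eq) presburger
  have fs: "layer_size m ?s = layer_size m (Suc i)"
    by (simp add: layer_size_def mod_mod_cancel)
  have cyc: "cycle_dist (4 * l) i ?s = 1" "cycle_dist (4 * l) ?s i = 1"
    using assms(1,3) s(2) by (auto simp: cycle_dist_def Suc_mod_eq)
  \<comment> \<open>The layers of the two endpoints avoid both runs, which makes the pieces counted
    below disjoint.\<close>
  have notin: "i \<notin> ?M ` {i + 2 * l + 1..<i + 4 * l}" "?s \<notin> ?M ` {i + 2 * l + 1..<i + 4 * l}"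
      "i \<notin> ?M ` {i + 2..<i + 2 * l + 1}" "?s \<notin> ?M ` {i + 2..<i + 2 * l + 1}"
    using assms(1,3) s(1) by (subst mem_mod_image_iff; auto simp: Suc_mod_eq)+
  have fin: "finite (?L a b)" for a b using finite_W_verts by simp
  have cardR: "card (?R p q) = layer_size m p - 1" if "(p, q) \<in> W_verts m l" for p q
    using that by (subst card_image) (auto simp: inj_on_def W_verts_def)
  \<comment> \<open>Needed because of truncated subtraction: \<open>1 + (layer_size m p - 1)\<close>
    must give back \<open>layer_size m p\<close>.\<close>
  have pos: "layer_size m p > 0" for p using assms(2) by (auto simp: layer_size_def)
  have dist: "closer_set (with_proj (W_graph m l)) x y = {z \<in> W_verts m l. W_dist l x z < W_dist l y z}"
    if "x \<in> W_verts m l" "y \<in> W_verts m l" for x y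
    using that assms(1,2) by (auto simp: closer_set_def graph_dist_W_graph)
  have less_iff: "W_dist l (i, j) z < W_dist l (?s, k) z \<longleftrightarrow>
        z = (i, j) \<or> z \<in> ?R ?s k \<or> z \<in> ?L (i + 2 * l + 1) (i + 4 * l)"
      "W_dist l (?s, k) z < W_dist l (i, j) z \<longleftrightarrow>
        z = (?s, k) \<or> z \<in> ?R i j \<or> z \<in> ?L (i + 2) (i + 2 * l + 1)"
    if z: "z \<in> W_verts m l" for z
  proof -
    obtain p q where [simp]: "z = (p, q)" by force
    have pq: "p < 4 * l" "q \<in> {1..layer_size m p}" using z by (auto simp: W_verts_def)
    \<comment> \<open>In the two end layers the comparison is between 0 or 2 and 1; elsewhere
      \<open>W_dist\<close> is the cycle distance.\<close>
    consider "p = i" | "p = ?s" | "p \<noteq> i" "p \<noteq> ?s" by blast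
    then have "(W_dist l (i, j) z < W_dist l (?s, k) z \<longleftrightarrow>
        z = (i, j) \<or> z \<in> ?R ?s k \<or> z \<in> ?L (i + 2 * l + 1) (i + 4 * l)) \<and>
      (W_dist l (?s, k) z < W_dist l (i, j) z \<longleftrightarrow>
        z = (?s, k) \<or> z \<in> ?R i j \<or> z \<in> ?L (i + 2) (i + 2 * l + 1))"
    proof cases
      case 1
      then show ?thesis using s cyc notin pq by (auto simp: W_dist_def)
    next
      case 2
      then show ?thesis using s cyc notin pq by (auto simp: W_dist_def)
    next
      case 3
      then show ?thesis
        using cycle_dist_less_iff[OF assms(3) pq(1) 3] z by (auto simp: W_dist_def)
    qed
    then show "W_dist l (i, j) z < W_dist l (?s, k) z \<longleftrightarrow>
        z = (i, j) \<or> z \<in> ?R ?s k \<or> z \<in> ?L (i + 2 * l + 1) (i + 4 * l)"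
      "W_dist l (?s, k) z < W_dist l (i, j) z \<longleftrightarrow>
        z = (?s, k) \<or> z \<in> ?R i j \<or> z \<in> ?L (i + 2) (i + 2 * l + 1)"
      by blast+
  qed
  have sub: "?R i j \<subseteq> W_verts m l" "?R ?s k \<subseteq> W_verts m l"
    using assms(3) s(1) by (auto simp: W_verts_def)
  have set_eq: "{z \<in> V. P z} = insert x (A \<union> B)"
    if "\<And>z. z \<in> V \<Longrightarrow> P z \<longleftrightarrow> z = x \<or> z \<in> A \<or> z \<in> B" "x \<in> V" "A \<subseteq> V" "B \<subseteq> V"
    for V A B :: "(nat \<times> nat) set" and P x
    using that by blast
  have "closer_set (with_proj (W_graph m l)) (i, j) (?s, k) =
      insert (i, j) (?R ?s k \<union> ?L (i + 2 * l + 1) (i + 4 * l))"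
    unfolding dist[OF u v] using sub u by (intro set_eq less_iff(1)) auto
  moreover have "card (?R ?s k \<union> ?L (i + 2 * l + 1) (i + 4 * l)) =
      card (?R ?s k) + card (?L (i + 2 * l + 1) (i + 4 * l))"
    using notin fin by (intro card_Un_disjoint) auto
  moreover have "(i, j) \<notin> ?R ?s k \<union> ?L (i + 2 * l + 1) (i + 4 * l)"
    using notin s by auto
  ultimately show ?closer_u
    using cardR[OF v] card_W_verts_layers[of l "i + 4 * l" "i + 2 * l + 1" m] assms(1) fin
      pos[of ?s] fs by simp
  have "closer_set (with_proj (W_graph m l)) (?s, k) (i, j) =
      insert (?s, k) (?R i j \<union> ?L (i + 2) (i + 2 * l + 1))"
    unfolding dist[OF v u] using sub v by (intro set_eq less_iff(2)) auto
  moreover have "card (?R i j \<union> ?L (i + 2) (i + 2 * l + 1)) =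
      card (?R i j) + card (?L (i + 2) (i + 2 * l + 1))"
    using notin fin by (intro card_Un_disjoint) auto
  moreover have "(?s, k) \<notin> ?R i j \<union> ?L (i + 2) (i + 2 * l + 1)"
    using notin s by auto
  ultimately show ?closer_v
    using cardR[OF u] card_W_verts_layers[of l "i + 2 * l + 1" "i + 2" m] assms(1) fin
      pos[of i] by simp
qed

section \<open>Sums of layer sizes and the parity of \<open>l\<close>\<close>

lemma layer_size_add_two: "layer_size m i + layer_size m (i + 2) = m + 1"
proof -
  have "i mod 4 = 0 \<and> (i + 2) mod 4 = 2 \<or> i mod 4 = 1 \<and> (i + 2) mod 4 = 3 \<or>
    i mod 4 = 2 \<and> (i + 2) mod 4 = 0 \<or> i mod 4 = 3 \<and> (i + 2) mod 4 = 1" by presburger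
  then show ?thesis unfolding layer_size_def by auto
qed

lemma layer_size_add_mult_four: "layer_size m (i + 4 * q) = layer_size m i"
  by (simp add: layer_size_def)

lemma sum_layer_size_periods:
  "(\<Sum>k = a..<a + 4 * q. layer_size m k) = 2 * q * (m + 1)"
proof (induction q)
  case (Suc q)
  \<comment> \<open>The four new terms are paired at index distance 2, so the sum does not depend on
    the offset \<open>a\<close>.\<close>
  have "(\<Sum>k = a..<a + 4 * Suc q. layer_size m k) =
    (\<Sum>k = a..<a + 4 * q. layer_size m k) +
    (layer_size m (a + 4 * q) + layer_size m (a + 4 * q + 2)) +
    (layer_size m (a + 4 * q + 1) + layer_size m (a + 4 * q + 1 + 2))"
    by (simp add: numeral_eq_Suc)
  then show ?case using Suc by (simp only: layer_size_add_two) simp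
qed simp

text \<open>For \<open>l = 2 * q + 1\<close> each run has \<open>4 * q + 1\<close> layers:
  \<open>q\<close> periods and one more layer, of the size of layer \<open>i + 3\<close> or
  \<open>i + 2\<close>. This layer complements layer \<open>i + 1\<close> or \<open>i\<close>,
  respectively, to \<open>m + 1\<close> vertices.\<close>

lemma distance_balanced_W_graph_odd:
  assumes "odd l" and "m \<ge> 1"
  shows "distance_balanced (with_proj (W_graph m l))"
proof -
  obtain q where l: "l = 2 * q + 1" using assms(1) by (rule oddE)
  have balanced: "card (closer_set (with_proj (W_graph m l)) (i, j) (Suc i mod (4 * l), k)) =
      card (closer_set (with_proj (W_graph m l)) (Suc i mod (4 * l), k) (i, j))"
    if "i < 4 * l" "(i, j) \<in> W_verts m l" "(Suc i mod (4 * l), k) \<in> W_verts m l" for i j k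
  proof -
    define c where "c = i + 2 * l + 1"
    have *: "(\<Sum>k = a..<a + 4 * q + 1. layer_size m k) = 2 * q * (m + 1) + layer_size m a" for a
      using sum_layer_size_periods[of m a q] layer_size_add_mult_four[of m a q] by simp
    have eqs: "i + 4 * l = c + 4 * q + 1" "i + 2 * l + 1 = i + 2 + 4 * q + 1" "c = i + 1 + 2 + 4 * q"
      by (simp_all add: c_def l)
    have "(\<Sum>k = i + 2 * l + 1..<i + 4 * l. layer_size m k) =
        2 * q * (m + 1) + layer_size m (i + 1 + 2)"
      using *[of c] unfolding c_def[symmetric] eqs(1)
      by (simp only: eqs(3) layer_size_add_mult_four)
    moreover have "(\<Sum>k = i + 2..<i + 2 * l + 1. layer_size m k) =
        2 * q * (m + 1) + layer_size m (i + 2)"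
      unfolding eqs(2) by (rule *)
    ultimately show ?thesis
      using card_closer_sets[OF _ assms(2) that] layer_size_add_two[of m i]
        layer_size_add_two[of m "i + 1"] l by simp
  qed
  have "card (closer_set (with_proj (W_graph m l)) u v) = card (closer_set (with_proj (W_graph m l)) v u)"
    if "u \<rightarrow>\<^bsub>with_proj (W_graph m l)\<^esub> v" for u v
  proof -
    obtain a j b k where uv: "u = (a, j)" "v = (b, k)" by (metis surj_pair)
    with that have "(a, j) \<in> W_verts m l" "(b, k) \<in> W_verts m l" "a < 4 * l" "b < 4 * l"
      "b = Suc a mod (4 * l) \<or> a = Suc b mod (4 * l)"
      by (auto simp: W_graph_adj_iff) (auto simp: W_verts_def)
    then show ?thesis using balanced[of a j k] balanced[of b k j] uv by metis
  qed
  then show ?thesis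
    using connected_W_graph[of l m] assms l by (auto simp: distance_balanced_def)
qed

lemma not_distance_balanced_W_graph_even:
  assumes "even l" and "l > 0" and "m \<ge> 2"
  shows "\<not> distance_balanced (with_proj (W_graph m l))"
proof
  assume bal: "distance_balanced (with_proj (W_graph m l))"
  \<comment> \<open>With this form a run has \<open>2 * l - 1 = 4 * q + 3\<close> layers:
    \<open>q\<close> periods and three more layers. Those are of the sizes of layers 1, 2, 3 on one
    side and 2, 3, 4 on the other, so \<open>3 * m + 1\<close> is compared with \<open>m + 3\<close>
    once the periods cancel.\<close>
  obtain q where l: "l = 2 * q + 2"
    using assms(1,2) by (metis evenE dvd_triv_left even_Suc_Suc_iff gr0_implies_Suc mult_Suc_right
        add.commute mult_0_right not_gr0)
  have verts: "(0, 1) \<in> W_verts m l" "(Suc 0 mod (4 * l), 1) \<in> W_verts m l"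
    using one_in_W_verts[of m _ l] assms by auto
  then have "(0, 1) \<rightarrow>\<^bsub>with_proj (W_graph m l)\<^esub> (Suc 0 mod (4 * l), 1)"
    by (simp add: W_graph_adj_iff)
  then have "card (closer_set (with_proj (W_graph m l)) (0, 1) (Suc 0 mod (4 * l), 1)) =
    card (closer_set (with_proj (W_graph m l)) (Suc 0 mod (4 * l), 1) (0, 1))"
    using bal unfolding distance_balanced_def by blast
  then have "layer_size m (Suc 0) + (\<Sum>k = 2 * l + 1..<4 * l. layer_size m k) =
    layer_size m 0 + (\<Sum>k = 2..<2 * l + 1. layer_size m k)"
    using card_closer_sets[OF assms(2) _ _ verts] assms by (simp add: numeral_2_eq_2)
  moreover have block: "(\<Sum>k = a + 4 * p..<a + 4 * p + 4 * q + 3. layer_size m k) =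
    2 * q * (m + 1) + layer_size m a + layer_size m (a + 1) + layer_size m (a + 2)" for a p
    using sum_layer_size_periods[of m "a + 4 * p" q] layer_size_add_mult_four[of m a "p + q"]
      layer_size_add_mult_four[of m "a + 1" "p + q"] layer_size_add_mult_four[of m "a + 2" "p + q"]
    by (simp add: numeral_eq_Suc algebra_simps)
  have "(\<Sum>k = 2 * l + 1..<4 * l. layer_size m k) =
    2 * q * (m + 1) + layer_size m 1 + layer_size m 2 + layer_size m 3"
  proof -
    have "2 * l + 1 = 1 + 4 * (q + 1)" "4 * l = 1 + 4 * (q + 1) + 4 * q + 3"
      by (simp_all add: l)
    moreover have "1 + 1 = (2 :: nat)" "1 + 2 = (3 :: nat)" by simp_all
    ultimately show ?thesis using block[of 1 "q + 1"] by (simp only:)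
  qed
  moreover have "(\<Sum>k = 2..<2 * l + 1. layer_size m k) =
    2 * q * (m + 1) + layer_size m 2 + layer_size m 3 + layer_size m 4"
  proof -
    have "2 * l + 1 = 2 + 4 * 0 + 4 * q + 3" by (simp add: l)
    moreover have "2 + 4 * 0 = (2 :: nat)" "2 + 1 = (3 :: nat)" "2 + 2 = (4 :: nat)" by simp_all
    ultimately show ?thesis using block[of 2 0] by (simp only:)
  qed
  ultimately have "layer_size m 1 + (layer_size m 1 + layer_size m 2 + layer_size m 3) =
    layer_size m 0 + (layer_size m 2 + layer_size m 3 + layer_size m 4)"
    by simp
  then show False using assms(3) by (simp add: layer_size_def)
qed

section \<open>Bipartiteness and the 2-cut\<close>

lemma bipartite_W_graph: "bipartite (with_proj (W_graph m l))"
  unfolding bipartite_def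
proof (intro exI conjI)
  let ?U = "{z \<in> W_verts m l. even (fst z)}" and ?V = "{z \<in> W_verts m l. odd (fst z)}"
  show "verts (with_proj (W_graph m l)) = ?U \<union> ?V" by auto
  show "?U \<inter> ?V = {}" by auto
  show "arcs_ends (with_proj (W_graph m l)) \<subseteq> ?U \<times> ?V \<union> ?V \<times> ?U"
  proof
    fix e assume e: "e \<in> arcs_ends (with_proj (W_graph m l))"
    obtain a j b k where [simp]: "e = ((a, j), (b, k))" by (metis surj_pair)
    have adj: "(a, j) \<in> W_verts m l" "(b, k) \<in> W_verts m l"
        "b = Suc a mod (4 * l) \<or> a = Suc b mod (4 * l)"
      using e by (simp_all add: W_graph_adj_iff)
    \<comment> \<open>The modulus is even, so the arcs that close the cycle also change
      parity.\<close>
    have "even (c mod (4 * l)) = even c" for c :: nat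
      by (simp add: dvd_mod_iff)
    then have "even a \<noteq> even b" using adj(3) by (metis even_Suc)
    then show "e \<in> ?U \<times> ?V \<union> ?V \<times> ?U" using adj(1,2) by auto
  qed
qed

lemma not_three_connected_W_graph:
  assumes "l \<ge> 2" and "m \<ge> 1"
  shows "\<not> three_connected (with_proj (W_graph m l))"
proof
  \<comment> \<open>The two vertices of \<open>?S\<close> are entire layers. Removing them separates
    layers 1 and 2 from layer 4, which exists because \<open>l \<ge> 2\<close>.\<close>
  let ?G = "with_proj (W_graph m l)" and ?S = "{(0, 1), (3, 1)} :: (nat \<times> nat) set"
  let ?H = "?G \<restriction> (verts ?G - ?S)"
  assume "three_connected ?G"
  moreover have "?S \<subseteq> verts ?G" using one_in_W_verts[of m _ l] assms by auto
  moreover have "card ?S \<le> 2" by simp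
  ultimately have "Digraph_Component.connected ?H"
    unfolding three_connected_def by (metis finite.emptyI finite.insertI)
  moreover have "(1, 1) \<in> verts ?H" "(4, 1) \<in> verts ?H"
    using one_in_W_verts[of m _ l] assms by auto
  ultimately have "((1, 1), (4, 1)) \<in> rtrancl_on (verts ?H) ((arcs_ends ?H)\<^sup>s)"
    by (simp add: connected_conv)
  \<comment> \<open>The invariant of a walk from \<open>(1, 1)\<close>: it never leaves layers 1 and
    2, since layers 0 and 3 are now empty and no step from 1 or 2 wraps around.\<close>
  then have "fst (4 :: nat, 1 :: nat) \<in> {1, 2}"
  proof (induction rule: rtrancl_on_induct)
    case (step y z)
    obtain a j b k where [simp]: "y = (a, j)" "z = (b, k)" by (metis surj_pair)
    have "y \<rightarrow>\<^bsub>?G\<^esub> z \<or> z \<rightarrow>\<^bsub>?G\<^esub> y"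
      using step(2) by (auto simp: symcl_def dest: dominates_induce_subgraphD)
    then have "b = Suc a mod (4 * l) \<or> a = Suc b mod (4 * l)" "b < 4 * l" "a < 4 * l"
      by (auto simp: W_graph_adj_iff) (auto simp: W_verts_def)
    then have "b = a + 1 \<or> a = b + 1"
      using step(5) assms(1) by (auto simp: Suc_mod_eq split: if_splits)
    moreover have "b \<noteq> 0" "b \<noteq> 3"
      using step(4) by (auto simp: W_verts_def layer_size_def intro: gr0I)
    ultimately show ?case using step(5) by auto
  qed simp
  then show False by simp
qed

theorem theorem3p6:
  fixes m l :: nat
  assumes "m \<ge> 2" and "l \<ge> 3"
  shows "bipartite (W_graph m l) \<and> \<not> three_connected (W_graph m l) \<and>
    (distance_balanced (W_graph m l) \<longleftrightarrow> odd l)"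
proof (intro conjI iffI)
  show "bipartite (W_graph m l)" by (rule bipartite_W_graph)
  show "\<not> three_connected (W_graph m l)"
    using not_three_connected_W_graph[of l m] assms by simp
  show "odd l" if "distance_balanced (W_graph m l)"
    using not_distance_balanced_W_graph_even[of l m] that assms by auto
  show "distance_balanced (W_graph m l)" if "odd l"
    using distance_balanced_W_graph_odd[of l m] that assms by simp
qed

end
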